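(* Let $c^*\colon\mathcal{E}_0^{\mathbf{U}}\to\mathcal{E}_0^{\mathbf{O}}$ be precomposition with complexification and let $c_!\colon\mathcal{E}_0^{\mathbf{O}}\to\mathcal{E}_0^{\mathbf{U}}$ be its left adjoint. The adjoint pair $c_!\colon\mathcal{E}_0^{\mathbf{O}}\rightleftarrows\mathcal{E}_0^{\mathbf{U}}\colon c^*$ is a Quillen adjunction when both categories are equipped with their projective model structures.
   Context: Let $\mathbb{F}$ be $\mathbb{R}$ or $\mathbb{C}$. $\mathsf{Top}_*$ is the category of based compactly generated weak Hausdorff spaces. $\mathcal{J}$ is the category of finite-dimensional $\mathbb{F}$-inner product subspaces of $\mathbb{F}^\infty$ and $\mathbb{F}$-linear isometries (not necessarily surjective), with $\mathcal{J}(U,V)$ topologised as a Stiefel manifold; $\mathcal{J}_0$ has the same objects and $\mathcal{J}_0(U,V)=\mathcal{J}(U,V)_+$. $\mathcal{E}_0$ is the category of $\mathsf{Top}_*$-enriched functors $\mathcal{J}_0 \to \mathsf{Top}_*$. A superscript $\mathbf{O}$ denotes the case $\mathbb{F}=\mathbb{R}$, a superscript $\mathbf{U}$ the case $\mathbb{F}=\mathbb{C}$. Projective model structure on $\mathcal{E}_0$: weak equivalences are levelwise weak homotopy equivalences and fibrations are levelwise Serre fibrations. Complexification $c\colon \mathcal{J}_0^{\mathbf{O}}\to\mathcal{J}_0^{\mathbf{U}}$ sends $V$ to $\mathbb{C}\otimes_{\mathbb{R}}V$ with the induced Hermitian inner product, and $T$ to $\mathbb{C}\otimes T$. $(c^*F)(V)=F(\mathbb{C}\otimes_{\mathbb{R}}V)$,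 and $c_!$ is the enriched left Kan extension along $c$. *)

theory Defs
  imports "HOL-Analysis.Analysis" "HOL-Library.Poly_Mapping"
begin

section \<open>Categories, adjunctions, model structures\<close>

record ('o, 'm) cat =
  Ob :: "'o set"
  Ar :: "'m set"
  dm :: "'m \<Rightarrow> 'o"
  cd :: "'m \<Rightarrow> 'o"
  idt :: "'o \<Rightarrow> 'm"
  cmp :: "'m \<Rightarrow> 'm \<Rightarrow> 'm"   \<comment> \<open>\<open>cmp C g f\<close> is \<open>g\<close> after \<open>f\<close>\<close>

definition homs :: "('o, 'm) cat \<Rightarrow> 'o \<Rightarrow> 'o \<Rightarrow> 'm set" where
  "homs C A B = {f \<in> Ar C. dm C f = A \<and> cd C f = B}"

definition is_category :: "('o, 'm) cat \<Rightarrow> bool" where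
  "is_category C \<longleftrightarrow>
     (\<forall>f\<in>Ar C. dm C f \<in> Ob C \<and> cd C f \<in> Ob C) \<and>
     (\<forall>A\<in>Ob C. idt C A \<in> homs C A A) \<and>
     (\<forall>f\<in>Ar C. \<forall>g\<in>Ar C. cd C f = dm C g \<longrightarrow> cmp C g f \<in> homs C (dm C f) (cd C g)) \<and>
     (\<forall>f\<in>Ar C. cmp C f (idt C (dm C f)) = f \<and> cmp C (idt C (cd C f)) f = f) \<and>
     (\<forall>f\<in>Ar C. \<forall>g\<in>Ar C. \<forall>h\<in>Ar C. cd C f = dm C g \<longrightarrow> cd C g = dm C h \<longrightarrow>
        cmp C h (cmp C g f) = cmp C (cmp C h g) f)"

record ('o, 'm, 'p, 'n) functr =
  omap :: "'o \<Rightarrow> 'p"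
  amap :: "'m \<Rightarrow> 'n"

definition is_functor ::
  "('o, 'm) cat \<Rightarrow> ('p, 'n) cat \<Rightarrow> ('o, 'm, 'p, 'n) functr \<Rightarrow> bool" where
  "is_functor C D L \<longleftrightarrow>
     (\<forall>A\<in>Ob C. omap L A \<in> Ob D) \<and>
     (\<forall>f\<in>Ar C. amap L f \<in> homs D (omap L (dm C f)) (omap L (cd C f))) \<and>
     (\<forall>A\<in>Ob C. amap L (idt C A) = idt D (omap L A)) \<and>
     (\<forall>f\<in>Ar C. \<forall>g\<in>Ar C. cd C f = dm C g \<longrightarrow>
        amap L (cmp C g f) = cmp D (amap L g) (amap L f))"

text \<open>\<open>\<phi> A B : D(L A, B) \<cong> C(A, R B)\<close>, natural in \<open>A\<close> and \<open>B\<close>.\<close>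

definition natural_hom_bijection ::
  "('o, 'm) cat \<Rightarrow> ('p, 'n) cat \<Rightarrow> ('o, 'm, 'p, 'n) functr \<Rightarrow> ('p, 'n, 'o, 'm) functr
     \<Rightarrow> ('o \<Rightarrow> 'p \<Rightarrow> 'n \<Rightarrow> 'm) \<Rightarrow> bool" where
  "natural_hom_bijection C D L R \<phi> \<longleftrightarrow>
     (\<forall>A\<in>Ob C. \<forall>B\<in>Ob D. bij_betw (\<phi> A B) (homs D (omap L A) B) (homs C A (omap R B))) \<and>
     (\<forall>A\<in>Ob C. \<forall>B\<in>Ob D. \<forall>A'\<in>Ob C. \<forall>a\<in>homs C A' A. \<forall>h\<in>homs D (omap L A) B.
        \<phi> A' B (cmp D h (amap L a)) = cmp C (\<phi> A B h) a) \<and>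
     (\<forall>A\<in>Ob C. \<forall>B\<in>Ob D. \<forall>B'\<in>Ob D. \<forall>b\<in>homs D B B'. \<forall>h\<in>homs D (omap L A) B.
        \<phi> A B' (cmp D b h) = cmp C (amap R b) (\<phi> A B h))"

definition adjunction ::
  "('o, 'm) cat \<Rightarrow> ('p, 'n) cat \<Rightarrow> ('o, 'm, 'p, 'n) functr \<Rightarrow> ('p, 'n, 'o, 'm) functr
     \<Rightarrow> ('o \<Rightarrow> 'p \<Rightarrow> 'n \<Rightarrow> 'm) \<Rightarrow> bool" where
  "adjunction C D L R \<phi> \<longleftrightarrow>
     is_category C \<and> is_category D \<and> is_functor C D L \<and> is_functor D C R \<and>
     natural_hom_bijection C D L R \<phi>"

record 'm model =
  weq :: "'m set"
  cof :: "'m set"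
  fib :: "'m set"

definition has_lifting :: "('o, 'm) cat \<Rightarrow> 'm \<Rightarrow> 'm \<Rightarrow> bool" where
  "has_lifting C i p \<longleftrightarrow>
     (\<forall>u\<in>homs C (dm C i) (dm C p). \<forall>v\<in>homs C (cd C i) (cd C p). cmp C p u = cmp C v i \<longrightarrow>
        (\<exists>h\<in>homs C (cd C i) (dm C p). cmp C h i = u \<and> cmp C p h = v))"

definition is_retract :: "('o, 'm) cat \<Rightarrow> 'm \<Rightarrow> 'm \<Rightarrow> bool" where
  "is_retract C f g \<longleftrightarrow>
     (\<exists>s\<in>homs C (dm C f) (dm C g). \<exists>r\<in>homs C (dm C g) (dm C f).
      \<exists>s'\<in>homs C (cd C f) (cd C g). \<exists>r'\<in>homs C (cd C g) (cd C f).
        cmp C r s = idt C (dm C f) \<and> cmp C r' s' = idt C (cd C f) \<and>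
        cmp C g s = cmp C s' f \<and> cmp C f r = cmp C r' g)"

definition model_structure :: "('o, 'm) cat \<Rightarrow> 'm model \<Rightarrow> bool" where
  "model_structure C M \<longleftrightarrow>
     weq M \<subseteq> Ar C \<and> cof M \<subseteq> Ar C \<and> fib M \<subseteq> Ar C \<and>
     (\<forall>f\<in>Ar C. \<forall>g\<in>Ar C. cd C f = dm C g \<longrightarrow>
        (f \<in> weq M \<and> g \<in> weq M \<longrightarrow> cmp C g f \<in> weq M) \<and>
        (f \<in> weq M \<and> cmp C g f \<in> weq M \<longrightarrow> g \<in> weq M) \<and>
        (g \<in> weq M \<and> cmp C g f \<in> weq M \<longrightarrow> f \<in> weq M)) \<and>
     (\<forall>f\<in>Ar C. \<forall>g\<in>Ar C. is_retract C f g \<longrightarrow>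
        (g \<in> weq M \<longrightarrow> f \<in> weq M) \<and> (g \<in> cof M \<longrightarrow> f \<in> cof M) \<and> (g \<in> fib M \<longrightarrow> f \<in> fib M)) \<and>
     (\<forall>i\<in>cof M. \<forall>p\<in>fib M. i \<in> weq M \<or> p \<in> weq M \<longrightarrow> has_lifting C i p) \<and>
     (\<forall>f\<in>Ar C. \<exists>i\<in>cof M \<inter> weq M. \<exists>p\<in>fib M. cd C i = dm C p \<and> cmp C p i = f) \<and>
     (\<forall>f\<in>Ar C. \<exists>i\<in>cof M. \<exists>p\<in>fib M \<inter> weq M. cd C i = dm C p \<and> cmp C p i = f)"

text \<open>\<open>L\<close> (the left adjoint) is left Quillen: it preserves cofibrations and acyclic cofibrations.\<close>

definition quillen_adjunction ::
  "('o, 'm) cat \<Rightarrow> 'm model \<Rightarrow> ('p, 'n) cat \<Rightarrow> 'n model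
     \<Rightarrow> ('o, 'm, 'p, 'n) functr \<Rightarrow> ('p, 'n, 'o, 'm) functr \<Rightarrow> ('o \<Rightarrow> 'p \<Rightarrow> 'n \<Rightarrow> 'm) \<Rightarrow> bool" where
  "quillen_adjunction C M D N L R \<phi> \<longleftrightarrow>
     model_structure C M \<and> model_structure D N \<and> adjunction C D L R \<phi> \<and>
     (\<forall>i\<in>cof M. amap L i \<in> cof N) \<and>
     (\<forall>i\<in>cof M \<inter> weq M. amap L i \<in> cof N \<inter> weq N)"


section \<open>Based compactly generated weak Hausdorff spaces\<close>

text \<open>
  The carriers of all spaces in one instance of \<open>Top\<^sub>*\<close> are subsets of a type \<open>'a\<close>, which
  plays the role of the universe. Test spaces \<open>K\<close> range over the larger type \<open>'a set set\<close>.
  This loses nothing for weak Hausdorffness: a map \<open>u : K \<rightarrow> X\<close> from an arbitrary compact Hausdorff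
  space has the same image as its restriction to the closure of some subset of \<open>K\<close> of cardinality
  at most that of \<open>X\<close>, and this closure has at most \<open>2^(2^card X)\<close> points. For weak Hausdorff \<open>X\<close>
  the image of \<open>u\<close> is a compact Hausdorff subspace of \<open>X\<close> with the quotient topology, so the
  same test spaces also suffice for compact generation.
\<close>

definition compact_test :: "'a set set topology \<Rightarrow> 'a topology \<Rightarrow> ('a set set \<Rightarrow> 'a) \<Rightarrow> bool" where
  "compact_test K X u \<longleftrightarrow> compact_space K \<and> Hausdorff_space K \<and> continuous_map K X u"

definition k_open :: "'a topology \<Rightarrow> 'a set \<Rightarrow> bool" where
  "k_open X S \<longleftrightarrow> S \<subseteq> topspace X \<and>
     (\<forall>K u. compact_test K X u \<longrightarrow> openin K {k \<in> topspace K. u k \<in> S})"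

lemma istopology_k_open: "istopology (k_open X)"
  unfolding istopology_def
proof (intro conjI allI impI)
  fix S T assume S: "k_open X S" and T: "k_open X T"
  show "k_open X (S \<inter> T)"
    unfolding k_open_def
  proof (intro conjI allI impI)
    show "S \<inter> T \<subseteq> topspace X" using S by (auto simp: k_open_def)
    fix K u assume "compact_test K X u"
    then have "openin K ({k \<in> topspace K. u k \<in> S} \<inter> {k \<in> topspace K. u k \<in> T})"
      using S T unfolding k_open_def by blast
    moreover have "{k \<in> topspace K. u k \<in> S} \<inter> {k \<in> topspace K. u k \<in> T}
        = {k \<in> topspace K. u k \<in> S \<inter> T}" by auto
    ultimately show "openin K {k \<in> topspace K. u k \<in> S \<inter> T}" by simp
  qed
next
  fix \<K> assume *: "\<forall>S\<in>\<K>. k_open X S"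
  show "k_open X (\<Union>\<K>)"
    unfolding k_open_def
  proof (intro conjI allI impI)
    show "\<Union>\<K> \<subseteq> topspace X" using * by (auto simp: k_open_def)
    fix K u assume "compact_test K X u"
    then have "openin K (\<Union>S\<in>\<K>. {k \<in> topspace K. u k \<in> S})"
      using * unfolding k_open_def by blast
    moreover have "(\<Union>S\<in>\<K>. {k \<in> topspace K. u k \<in> S}) = {k \<in> topspace K. u k \<in> \<Union>\<K>}" by auto
    ultimately show "openin K {k \<in> topspace K. u k \<in> \<Union>\<K>}" by simp
  qed
qed

definition kify :: "'a topology \<Rightarrow> 'a topology" where
  "kify X = topology (k_open X)"

definition compactly_generated :: "'a topology \<Rightarrow> bool" where
  "compactly_generated X \<longleftrightarrow> (\<forall>S. k_open X S \<longrightarrow> openin X S)"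

definition weak_Hausdorff :: "'a topology \<Rightarrow> bool" where
  "weak_Hausdorff X \<longleftrightarrow> (\<forall>K u. compact_test K X u \<longrightarrow> closedin X (u ` topspace K))"

type_synonym 'a based = "'a topology \<times> 'a"

definition top_based :: "'a based \<Rightarrow> bool" where
  "top_based X \<longleftrightarrow> compactly_generated (fst X) \<and> weak_Hausdorff (fst X) \<and> snd X \<in> topspace (fst X)"

text \<open>Maps are made extensional, so that equal maps are equal as HOL functions.\<close>

definition based_maps :: "'a based \<Rightarrow> 'b based \<Rightarrow> ('a \<Rightarrow> 'b) set" where
  "based_maps X Y =
     {f \<in> extensional (topspace (fst X)). continuous_map (fst X) (fst Y) f \<and> f (snd X) = snd Y}"

text \<open>
  The internal hom of \<open>Top\<^sub>*\<close>: the compact-open topology, k-ified; the base point is the constant map.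
\<close>

definition map_space :: "'a based \<Rightarrow> 'b based \<Rightarrow> ('a \<Rightarrow> 'b) based" where
  "map_space X Y =
     (kify (topology_generated_by
        {{f \<in> based_maps X Y. f ` K \<subseteq> U} | K U.
           compactin (fst X) K \<and> Hausdorff_space (subtopology (fst X) K) \<and> openin (fst Y) U}),
      restrict (\<lambda>_. snd Y) (topspace (fst X)))"


section \<open>Weak homotopy equivalences and Serre fibrations\<close>

definition cube :: "nat \<Rightarrow> (nat \<Rightarrow> real) topology" where
  "cube n = product_topology (\<lambda>_. top_of_set {0..1}) {..<n}"

definition cube_boundary :: "nat \<Rightarrow> (nat \<Rightarrow> real) set" where
  "cube_boundary n = {s \<in> topspace (cube n). \<exists>i<n. s i = 0 \<or> s i = 1}"

definition sphere_maps :: "nat \<Rightarrow> 'a topology \<Rightarrow> 'a \<Rightarrow> ((nat \<Rightarrow> real) \<Rightarrow> 'a) set" where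
  "sphere_maps n X x = {g. continuous_map (cube n) X g \<and> g ` cube_boundary n \<subseteq> {x}}"

definition sphere_homotopy ::
  "nat \<Rightarrow> 'a topology \<Rightarrow> 'a \<Rightarrow> (((nat \<Rightarrow> real) \<Rightarrow> 'a) \<times> ((nat \<Rightarrow> real) \<Rightarrow> 'a)) set" where
  "sphere_homotopy n X x = {(g, h). g \<in> sphere_maps n X x \<and> h \<in> sphere_maps n X x \<and>
     homotopic_with (\<lambda>k. k ` cube_boundary n \<subseteq> {x}) (cube n) X g h}"

text \<open>The underlying set of \<open>\<pi>\<^sub>n(X, x)\<close>; for \<open>n = 0\<close> it is the set of path components.\<close>

definition homotopy_set :: "nat \<Rightarrow> 'a topology \<Rightarrow> 'a \<Rightarrow> ((nat \<Rightarrow> real) \<Rightarrow> 'a) set set" where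
  "homotopy_set n X x = sphere_maps n X x // sphere_homotopy n X x"

definition weak_homotopy_equivalence :: "'a topology \<Rightarrow> 'b topology \<Rightarrow> ('a \<Rightarrow> 'b) \<Rightarrow> bool" where
  "weak_homotopy_equivalence X Y f \<longleftrightarrow> continuous_map X Y f \<and>
     (topspace X = {} \<longrightarrow> topspace Y = {}) \<and>
     (\<forall>n. \<forall>x\<in>topspace X.
        bij_betw (\<lambda>c. sphere_homotopy n Y (f x) `` ((\<lambda>g. f \<circ> g) ` c))
          (homotopy_set n X x) (homotopy_set n Y (f x)))"

definition serre_fibration :: "'a topology \<Rightarrow> 'b topology \<Rightarrow> ('a \<Rightarrow> 'b) \<Rightarrow> bool" where
  "serre_fibration E B p \<longleftrightarrow> continuous_map E B p \<and>
     (\<forall>n g H. continuous_map (cube n) E g \<longrightarrow>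
        continuous_map (prod_topology (cube n) (top_of_set {0..1::real})) B H \<longrightarrow>
        (\<forall>s\<in>topspace (cube n). H (s, 0) = p (g s)) \<longrightarrow>
        (\<exists>G. continuous_map (prod_topology (cube n) (top_of_set {0..1::real})) E G \<and>
           (\<forall>s\<in>topspace (cube n). G (s, 0) = g s) \<and>
           (\<forall>s\<in>topspace (cube n). \<forall>t\<in>{0..1}. p (G (s, t)) = H (s, t))))"


section \<open>Enriched functors to \<open>Top\<^sub>*\<close>\<close>

text \<open>A (small) \<open>Top\<^sub>*\<close>-enriched category; \<open>hcomp J U V W g f\<close> is \<open>g\<close> after \<open>f\<close>.\<close>

record ('o, 'm) ecat =
  eOb :: "'o set"
  hom_space :: "'o \<Rightarrow> 'o \<Rightarrow> 'm based"
  hid :: "'o \<Rightarrow> 'm"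
  hcomp :: "'o \<Rightarrow> 'o \<Rightarrow> 'o \<Rightarrow> 'm \<Rightarrow> 'm \<Rightarrow> 'm"

abbreviation ehom :: "('o, 'm) ecat \<Rightarrow> 'o \<Rightarrow> 'o \<Rightarrow> 'm set" where
  "ehom J U V \<equiv> topspace (fst (hom_space J U V))"

record ('o, 'm, 'a) efunctor =
  fob :: "'o \<Rightarrow> 'a based"
  fmap :: "'o \<Rightarrow> 'o \<Rightarrow> 'm \<Rightarrow> 'a \<Rightarrow> 'a"

definition enriched_functor :: "('o, 'm) ecat \<Rightarrow> ('o, 'm, 'a) efunctor \<Rightarrow> bool" where
  "enriched_functor J F \<longleftrightarrow>
     (\<forall>V\<in>eOb J. top_based (fob F V)) \<and>
     (\<forall>U\<in>eOb J. \<forall>V\<in>eOb J.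
        continuous_map (fst (hom_space J U V)) (fst (map_space (fob F U) (fob F V))) (fmap F U V) \<and>
        fmap F U V (snd (hom_space J U V)) = snd (map_space (fob F U) (fob F V))) \<and>
     (\<forall>V\<in>eOb J. fmap F V V (hid J V) = restrict id (topspace (fst (fob F V)))) \<and>
     (\<forall>U\<in>eOb J. \<forall>V\<in>eOb J. \<forall>W\<in>eOb J. \<forall>f\<in>ehom J U V. \<forall>g\<in>ehom J V W.
        fmap F U W (hcomp J U V W g f)
          = compose (topspace (fst (fob F U))) (fmap F V W g) (fmap F U V f)) \<and>
     fob F \<in> extensional (eOb J) \<and>
     (\<forall>U V f. U \<notin> eOb J \<or> V \<notin> eOb J \<or> f \<notin> ehom J U V \<longrightarrow> fmap F U V f = undefined)"

record ('o, 'm, 'a) etrans =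
  src :: "('o, 'm, 'a) efunctor"
  tgt :: "('o, 'm, 'a) efunctor"
  comp :: "'o \<Rightarrow> 'a \<Rightarrow> 'a"

definition enriched_trans :: "('o, 'm) ecat \<Rightarrow> ('o, 'm, 'a) etrans \<Rightarrow> bool" where
  "enriched_trans J \<eta> \<longleftrightarrow>
     enriched_functor J (src \<eta>) \<and> enriched_functor J (tgt \<eta>) \<and>
     comp \<eta> \<in> extensional (eOb J) \<and>
     (\<forall>V\<in>eOb J. comp \<eta> V \<in> based_maps (fob (src \<eta>) V) (fob (tgt \<eta>) V)) \<and>
     (\<forall>U\<in>eOb J. \<forall>V\<in>eOb J. \<forall>f\<in>ehom J U V. \<forall>x\<in>topspace (fst (fob (src \<eta>) U)).
        comp \<eta> V (fmap (src \<eta>) U V f x) = fmap (tgt \<eta>) U V f (comp \<eta> U x))"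

definition functor_cat ::
  "('o, 'm) ecat \<Rightarrow> (('o, 'm, 'a) efunctor, ('o, 'm, 'a) etrans) cat" where
  "functor_cat J = \<lparr>
     Ob = {F. enriched_functor J F},
     Ar = {\<eta>. enriched_trans J \<eta>},
     dm = src,
     cd = tgt,
     idt = (\<lambda>F. \<lparr>src = F, tgt = F,
        comp = (\<lambda>V\<in>eOb J. restrict id (topspace (fst (fob F V))))\<rparr>),
     cmp = (\<lambda>\<theta> \<eta>. \<lparr>src = src \<eta>, tgt = tgt \<theta>,
        comp = (\<lambda>V\<in>eOb J. compose (topspace (fst (fob (src \<eta>) V))) (comp \<theta> V) (comp \<eta> V))\<rparr>)\<rparr>"

definition levelwise_weq :: "('o, 'm) ecat \<Rightarrow> ('o, 'm, 'a) etrans set" where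
  "levelwise_weq J = {\<eta>. enriched_trans J \<eta> \<and> (\<forall>V\<in>eOb J.
     weak_homotopy_equivalence (fst (fob (src \<eta>) V)) (fst (fob (tgt \<eta>) V)) (comp \<eta> V))}"

definition levelwise_fib :: "('o, 'm) ecat \<Rightarrow> ('o, 'm, 'a) etrans set" where
  "levelwise_fib J = {\<eta>. enriched_trans J \<eta> \<and> (\<forall>V\<in>eOb J.
     serre_fibration (fst (fob (src \<eta>) V)) (fst (fob (tgt \<eta>) V)) (comp \<eta> V))}"

text \<open>The cofibrations of a model structure are determined by the other two classes.\<close>

definition projective_model_structure ::
  "('o, 'm) ecat \<Rightarrow> ('o, 'm, 'a) etrans model \<Rightarrow> bool" where
  "projective_model_structure J M \<longleftrightarrow>
     model_structure (functor_cat J) M \<and> weq M = levelwise_weq J \<and> fib M = levelwise_fib J"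

text \<open>Precomposition with an enriched functor \<open>J \<rightarrow> J'\<close>, given by \<open>k\<close> on objects and \<open>\<kappa>\<close> on homs.\<close>

definition precomp_ob ::
  "('o, 'm) ecat \<Rightarrow> ('o \<Rightarrow> 'p) \<Rightarrow> ('o \<Rightarrow> 'o \<Rightarrow> 'm \<Rightarrow> 'n) \<Rightarrow> ('p, 'n, 'a) efunctor \<Rightarrow> ('o, 'm, 'a) efunctor"
  where
  "precomp_ob J k \<kappa> F = \<lparr>
     fob = (\<lambda>V\<in>eOb J. fob F (k V)),
     fmap = (\<lambda>U V f. if U \<in> eOb J \<and> V \<in> eOb J \<and> f \<in> ehom J U V
        then fmap F (k U) (k V) (\<kappa> U V f) else undefined)\<rparr>"

definition precomp ::
  "('o, 'm) ecat \<Rightarrow> ('o \<Rightarrow> 'p) \<Rightarrow> ('o \<Rightarrow> 'o \<Rightarrow> 'm \<Rightarrow> 'n)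
     \<Rightarrow> (('p, 'n, 'a) efunctor, ('p, 'n, 'a) etrans, ('o, 'm, 'a) efunctor, ('o, 'm, 'a) etrans) functr"
  where
  "precomp J k \<kappa> = \<lparr>
     omap = precomp_ob J k \<kappa>,
     amap = (\<lambda>\<eta>. \<lparr>src = precomp_ob J k \<kappa> (src \<eta>), tgt = precomp_ob J k \<kappa> (tgt \<eta>),
        comp = (\<lambda>V\<in>eOb J. comp \<eta> (k V))\<rparr>)\<rparr>"


section \<open>The categories \<open>J\<^sub>0\<close> and complexification\<close>

class scalar = real_normed_field +
  fixes conj :: "'a \<Rightarrow> 'a"
  assumes conj_mult_self: "conj x * x = ((norm x)\<^sup>2) *\<^sub>R 1"

instantiation real :: scalar
begin
definition conj_real :: "real \<Rightarrow> real" where "conj_real x = x"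
instance by standard (simp add: conj_real_def power2_eq_square)
end

instantiation complex :: scalar
begin
definition conj_complex :: "complex \<Rightarrow> complex" where "conj_complex = cnj"
instance
proof
  fix x :: complex
  show "conj x * x = ((norm x)\<^sup>2) *\<^sub>R 1"
    using complex_norm_square[of x] by (simp add: conj_complex_def mult.commute scaleR_conv_of_real)
qed
end

text \<open>\<open>\<bbbF>\<^sup>\<infinity>\<close> is the space of finitely supported sequences.\<close>

type_synonym 'f seqs = "nat \<Rightarrow>\<^sub>0 'f"

definition scl :: "'f::scalar \<Rightarrow> 'f seqs \<Rightarrow> 'f seqs" where
  "scl c x = Poly_Mapping.map ((*) c) x"

lemma lookup_scl: "Poly_Mapping.lookup (scl c x) i = c * Poly_Mapping.lookup x i"
  by (simp add: scl_def Poly_Mapping.map.rep_eq when_def)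

lemma vector_space_scl: "vector_space (scl :: 'f::scalar \<Rightarrow> _)"
  by unfold_locales (auto intro!: poly_mapping_eqI simp: lookup_scl lookup_add algebra_simps)

definition inner_seq :: "'f::scalar seqs \<Rightarrow> 'f seqs \<Rightarrow> 'f" where
  "inner_seq x y = (\<Sum>i\<in>Poly_Mapping.keys x. conj (Poly_Mapping.lookup x i) * Poly_Mapping.lookup y i)"

definition norm_seq :: "'f::scalar seqs \<Rightarrow> real" where
  "norm_seq x = sqrt (norm (inner_seq x x))"

definition fd_subspace :: "'f::scalar seqs set \<Rightarrow> bool" where
  "fd_subspace V \<longleftrightarrow> (\<exists>B. finite B \<and> V = module.span scl B)"

definition lin_isometries ::
  "'f::scalar seqs set \<Rightarrow> 'f seqs set \<Rightarrow> ('f seqs \<Rightarrow> 'f seqs) set" where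
  "lin_isometries U V = {T \<in> extensional U. T ` U \<subseteq> V \<and>
     (\<forall>x\<in>U. \<forall>y\<in>U. T (x + y) = T x + T y) \<and>
     (\<forall>c. \<forall>x\<in>U. T (scl c x) = scl c (T x)) \<and>
     (\<forall>x\<in>U. \<forall>y\<in>U. inner_seq (T x) (T y) = inner_seq x y)}"

text \<open>
  The Stiefel manifold topology: \<open>lin_isometries U V\<close> as a subspace of the finite-dimensional vector
  space \<open>Hom(U, V)\<close>, here via the operator norm. The guard is needed because \<open>Metric_space\<close> demands
  nonnegativity also off the carrier, where the supremum need not exist.
\<close>

definition op_dist ::
  "'f::scalar seqs set \<Rightarrow> 'f seqs set \<Rightarrow> ('f seqs \<Rightarrow> 'f seqs) \<Rightarrow> ('f seqs \<Rightarrow> 'f seqs) \<Rightarrow> real" where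
  "op_dist U V S T =
     (if S \<in> lin_isometries U V \<and> T \<in> lin_isometries U V
      then (SUP x\<in>{x \<in> U. norm_seq x \<le> 1}. norm_seq (S x - T x)) else 0)"

lemma norm_seq_eq_L2_set:
  assumes "finite A" "Poly_Mapping.keys x \<subseteq> A"
  shows "norm_seq x = L2_set (\<lambda>i. norm (Poly_Mapping.lookup x i)) A"
proof -
  have "inner_seq x x = (\<Sum>i\<in>Poly_Mapping.keys x. ((norm (Poly_Mapping.lookup x i))\<^sup>2) *\<^sub>R 1)"
    by (simp add: inner_seq_def conj_mult_self)
  also have "\<dots> = (\<Sum>i\<in>A. ((norm (Poly_Mapping.lookup x i))\<^sup>2) *\<^sub>R 1)"
    using assms by (intro sum.mono_neutral_left) (auto simp: in_keys_iff)
  also have "\<dots> = (\<Sum>i\<in>A. (norm (Poly_Mapping.lookup x i))\<^sup>2) *\<^sub>R 1" by (simp add: scaleR_left.sum)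
  finally show ?thesis by (simp add: norm_seq_def L2_set_def sum_nonneg)
qed

lemma norm_seq_nonneg: "0 \<le> norm_seq x" by (simp add: norm_seq_def)

lemma norm_seq_eq_0_iff: "norm_seq x = 0 \<longleftrightarrow> x = 0"
proof
  assume "norm_seq x = 0"
  then have "\<forall>i\<in>Poly_Mapping.keys x. norm (Poly_Mapping.lookup x i) = 0"
    by (subst (asm) norm_seq_eq_L2_set[of "Poly_Mapping.keys x"]) (auto simp: L2_set_eq_0_iff)
  then show "x = 0" by (auto intro!: poly_mapping_eqI simp: in_keys_iff)
qed (simp add: norm_seq_def inner_seq_def)

lemma norm_seq_minus: "norm_seq (- x) = norm_seq x"
  by (simp add: norm_seq_eq_L2_set[of "Poly_Mapping.keys x"] keys_minus)

lemma norm_seq_triangle: "norm_seq (x + y) \<le> norm_seq x + norm_seq y"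
proof -
  let ?A = "Poly_Mapping.keys x \<union> Poly_Mapping.keys y"
  have "norm_seq (x + y) = L2_set (\<lambda>i. norm (Poly_Mapping.lookup x i + Poly_Mapping.lookup y i)) ?A"
    by (simp add: norm_seq_eq_L2_set[of ?A] Poly_Mapping.keys_add lookup_add)
  also have "\<dots> \<le> L2_set (\<lambda>i. norm (Poly_Mapping.lookup x i) + norm (Poly_Mapping.lookup y i)) ?A"
    by (intro L2_set_mono norm_triangle_ineq) auto
  also have "\<dots> \<le> L2_set (\<lambda>i. norm (Poly_Mapping.lookup x i)) ?A + L2_set (\<lambda>i. norm (Poly_Mapping.lookup y i)) ?A"
    by (rule L2_set_triangle_ineq)
  also have "\<dots> = norm_seq x + norm_seq y" by (simp add: norm_seq_eq_L2_set[of ?A])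
  finally show ?thesis .
qed

lemma fd_subspace_0: "fd_subspace V \<Longrightarrow> 0 \<in> V"
proof -
  interpret vector_space "scl :: 'a \<Rightarrow> _" by (rule vector_space_scl)
  show "fd_subspace V \<Longrightarrow> 0 \<in> V" by (auto simp: fd_subspace_def span_zero)
qed

lemma fd_subspace_scl: "fd_subspace V \<Longrightarrow> x \<in> V \<Longrightarrow> scl c x \<in> V"
proof -
  interpret vector_space "scl :: 'a \<Rightarrow> _" by (rule vector_space_scl)
  show "fd_subspace V \<Longrightarrow> x \<in> V \<Longrightarrow> scl c x \<in> V" by (auto simp: fd_subspace_def span_scale)
qed

lemma norm_seq_scl: "norm_seq (scl c x) = norm c * norm_seq x"
proof -
  have "Poly_Mapping.keys (scl c x) \<subseteq> Poly_Mapping.keys x" by (auto simp: in_keys_iff lookup_scl)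
  then show ?thesis
    by (simp add: norm_seq_eq_L2_set[of "Poly_Mapping.keys x"] lookup_scl norm_mult L2_set_right_distrib)
qed

lemma bdd_op_dist:
  assumes "S \<in> lin_isometries U V" "T \<in> lin_isometries U V"
  shows "bdd_above ((\<lambda>x. norm_seq (S x - T x)) ` {x \<in> U. norm_seq x \<le> 1})"
proof (rule bdd_aboveI2[where M = 2])
  fix x assume x: "x \<in> {x \<in> U. norm_seq x \<le> 1}"
  have "norm_seq (S x - T x) \<le> norm_seq (S x) + norm_seq (T x)"
    using norm_seq_triangle[of "S x" "- T x"] by (simp add: norm_seq_minus)
  also have "\<dots> = norm_seq x + norm_seq x"
    using assms x by (simp add: norm_seq_def lin_isometries_def)
  finally show "norm_seq (S x - T x) \<le> 2" using x by simp
qed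

lemma Metric_space_op_dist:
  assumes U: "fd_subspace U"
  shows "Metric_space (lin_isometries U V) (op_dist U V)"
proof
  let ?B = "{x \<in> U. norm_seq x \<le> 1}"
  have 0: "0 \<in> ?B" using fd_subspace_0[OF U] by (simp add: norm_seq_eq_0_iff[THEN iffD2])
  have up: "norm_seq (S x - T x) \<le> op_dist U V S T"
    if "S \<in> lin_isometries U V" "T \<in> lin_isometries U V" "x \<in> ?B" for S T x
    using that bdd_op_dist[OF that(1,2)] unfolding op_dist_def by (auto intro!: cSUP_upper)
  show "0 \<le> op_dist U V S T" for S T
    using up[OF _ _ 0, of S T] norm_seq_nonneg[of "S 0 - T 0"]
    by (cases "S \<in> lin_isometries U V \<and> T \<in> lin_isometries U V") (auto simp: op_dist_def)
  have sym: "norm_seq (S x - T x) = norm_seq (T x - S x)" for S T :: "'a seqs \<Rightarrow> 'a seqs" and x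
    using norm_seq_minus[of "S x - T x"] by simp
  show "op_dist U V S T = op_dist U V T S" for S T
    unfolding op_dist_def by (subst sym) auto
  show "op_dist U V S T = 0 \<longleftrightarrow> S = T"
    if S: "S \<in> lin_isometries U V" and T: "T \<in> lin_isometries U V" for S T
  proof
    assume d: "op_dist U V S T = 0"
    have "S x = T x" if x: "x \<in> U" for x
    proof (cases "x = 0")
      case True
      then show ?thesis using up[OF S T 0] d
        by (simp add: norm_seq_nonneg norm_seq_eq_0_iff order_antisym_conv)
    next
      case False
      define c :: 'a where "c = of_real (inverse (norm_seq x))"
      have n: "norm_seq x > 0" using False norm_seq_nonneg[of x] norm_seq_eq_0_iff[of x] by simp
      have "scl c x \<in> ?B"
        using n x fd_subspace_scl[OF U] by (simp add: norm_seq_scl c_def norm_inverse)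
      from up[OF S T this] d have "S (scl c x) - T (scl c x) = 0"
        by (simp add: norm_seq_nonneg norm_seq_eq_0_iff order_antisym_conv)
      then have "scl c (S x) = scl c (T x)" using S T x by (simp add: lin_isometries_def)
      then have "c * Poly_Mapping.lookup (S x) i = c * Poly_Mapping.lookup (T x) i" for i by (metis lookup_scl)
      moreover have "c \<noteq> 0" using n by (simp add: c_def)
      ultimately show ?thesis by (auto intro: poly_mapping_eqI)
    qed
    then show "S = T" using S T unfolding lin_isometries_def by (auto intro: extensionalityI)
  next
    assume "S = T"
    moreover have "norm_seq (0 :: 'a seqs) = 0" by (simp add: norm_seq_eq_0_iff)
    moreover have "?B \<noteq> {}" using 0 by blast
    then have "(SUP x\<in>?B. 0 :: real) = 0" by (rule cSUP_const)
    ultimately show "op_dist U V S T = 0" by (simp add: op_dist_def)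
  qed
  show "op_dist U V R T \<le> op_dist U V R S + op_dist U V S T"
    if R: "R \<in> lin_isometries U V" and S: "S \<in> lin_isometries U V" and T: "T \<in> lin_isometries U V"
    for R S T
  proof -
    have "norm_seq (R x - T x) \<le> op_dist U V R S + op_dist U V S T" if x: "x \<in> ?B" for x
      using norm_seq_triangle[of "R x - S x" "S x - T x"] up[OF R S x] up[OF S T x] by simp
    then show ?thesis using R T 0 unfolding op_dist_def[of U V R T] by (auto intro!: cSUP_least)
  qed
qed

definition stiefel :: "'f::scalar seqs set \<Rightarrow> 'f seqs set \<Rightarrow> ('f seqs \<Rightarrow> 'f seqs) topology" where
  "stiefel U V = Metric_space.mtopology (lin_isometries U V) (op_dist U V)"

text \<open>The disjoint base point of \<open>X\<^sub>+\<close> is \<open>None\<close>.\<close>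

definition plus_open :: "'a topology \<Rightarrow> 'a option set \<Rightarrow> bool" where
  "plus_open X S \<longleftrightarrow> openin X {x. Some x \<in> S}"

lemma istopology_plus_open: "istopology (plus_open X)"
  unfolding istopology_def
proof (intro conjI allI impI)
  fix S T assume "plus_open X S" "plus_open X T"
  then have "openin X ({x. Some x \<in> S} \<inter> {x. Some x \<in> T})"
    unfolding plus_open_def by blast
  then show "plus_open X (S \<inter> T)" by (simp add: plus_open_def Collect_conj_eq)
next
  fix \<K> assume "\<forall>S\<in>\<K>. plus_open X S"
  then have "openin X (\<Union>S\<in>\<K>. {x. Some x \<in> S})" unfolding plus_open_def by blast
  moreover have "(\<Union>S\<in>\<K>. {x. Some x \<in> S}) = {x. Some x \<in> \<Union>\<K>}" by auto
  ultimately show "plus_open X (\<Union>\<K>)" by (simp add: plus_open_def)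
qed

definition plus_space :: "'a topology \<Rightarrow> 'a option based" where
  "plus_space X = (topology (plus_open X), None)"

type_synonym 'f j_ob = "'f seqs set"
type_synonym 'f j_mor = "('f seqs \<Rightarrow> 'f seqs) option"

definition J0 :: "('f::scalar j_ob, 'f j_mor) ecat" where
  "J0 = \<lparr>
     eOb = {V. fd_subspace V},
     hom_space = (\<lambda>U V. plus_space (stiefel U V)),
     hid = (\<lambda>V. Some (restrict id V)),
     hcomp = (\<lambda>U V W g f. case (g, f) of
        (Some T, Some S) \<Rightarrow> Some (compose U T S) | _ \<Rightarrow> None)\<rparr>"

abbreviation J0_O :: "(real j_ob, real j_mor) ecat" where "J0_O \<equiv> J0"
abbreviation J0_U :: "(complex j_ob, complex j_mor) ecat" where "J0_U \<equiv> J0"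

type_synonym 'a ob_O = "(real j_ob, real j_mor, 'a) efunctor"
type_synonym 'a ar_O = "(real j_ob, real j_mor, 'a) etrans"
type_synonym 'a ob_U = "(complex j_ob, complex j_mor, 'a) efunctor"
type_synonym 'a ar_U = "(complex j_ob, complex j_mor, 'a) etrans"

abbreviation E0_O :: "('a ob_O, 'a ar_O) cat" where "E0_O \<equiv> functor_cat J0_O"
abbreviation E0_U :: "('a ob_U, 'a ar_U) cat" where "E0_U \<equiv> functor_cat J0_U"

text \<open>
  \<open>\<complex> \<otimes> \<real>\<^sup>\<infinity>\<close> with the induced Hermitian inner product is identified with \<open>\<complex>\<^sup>\<infinity>\<close> via
  \<open>z \<otimes> x \<mapsto> z x\<close>. Under this isometry \<open>\<complex> \<otimes> V\<close> is the subspace \<open>V + iV\<close>, and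
  \<open>\<complex> \<otimes> T\<close> is \<open>x + iy \<mapsto> T x + i T y\<close>.
\<close>

definition cplx :: "real seqs \<Rightarrow> real seqs \<Rightarrow> complex seqs" where
  "cplx x y = Poly_Mapping.map complex_of_real x + scl \<i> (Poly_Mapping.map complex_of_real y)"

definition c_ob :: "real j_ob \<Rightarrow> complex j_ob" where
  "c_ob V = {cplx x y | x y. x \<in> V \<and> y \<in> V}"

definition c_mor :: "real j_ob \<Rightarrow> real j_ob \<Rightarrow> real j_mor \<Rightarrow> complex j_mor" where
  "c_mor U V = map_option (\<lambda>T. \<lambda>z\<in>c_ob U.
     cplx (T (Poly_Mapping.map Re z)) (T (Poly_Mapping.map Im z)))"

definition c_star :: "('a ob_U, 'a ar_U, 'a ob_O, 'a ar_O) functr" where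
  "c_star = precomp J0_O c_ob c_mor"

end

theory Submission
  imports Defs
begin

text \<open>
  A map \<open>L i\<close> lifts against \<open>p\<close> as soon as \<open>i\<close> lifts against \<open>R p\<close>, and by the retract argument
  the (acyclic) cofibrations of a model structure are exactly the maps lifting against the acyclic
  fibrations (the fibrations). So it suffices that \<open>c\<^sup>*\<close> preserves fibrations and acyclic
  fibrations. These are levelwise, and the level of \<open>c\<^sup>* p\<close> at \<open>V\<close> is the level of \<open>p\<close> at
  \<open>\<complex> \<otimes> V\<close>. That \<open>c\<^sup>*\<close> takes values in enriched functors needs complexification to be
  continuous on Stiefel manifolds: it is Lipschitz with constant \<open>2\<close> for the operator norms.
\<close>

section \<open>Right adjoints preserving (acyclic) fibrations\<close>

lemma cmp_in_homs:
  assumes "is_category C" "f \<in> homs C A B" "g \<in> homs C B D"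
  shows "cmp C g f \<in> homs C A D"
  using assms unfolding is_category_def homs_def by force

lemma functor_in_homs:
  "is_functor C D L \<Longrightarrow> f \<in> homs C A B \<Longrightarrow> amap L f \<in> homs D (omap L A) (omap L B)"
  unfolding is_functor_def homs_def by force

text \<open>The retract argument. In the square with \<open>j\<close> on top, an identity at the
  bottom, \<open>i\<close> on the left and \<open>p\<close> on the right, a lift \<open>h\<close> is
  a section of \<open>p\<close>. Then \<open>h\<close> and \<open>p\<close> on codomains, with
  identities on domains, exhibit \<open>i\<close> as a retract of \<open>j\<close>.\<close>

lemma retract_of_left_factor:
  assumes C: "is_category C" and i: "i \<in> Ar C" and j: "j \<in> Ar C" and p: "p \<in> Ar C"
    and jp: "cd C j = dm C p" and fact: "cmp C p j = i" and lift: "has_lifting C i p"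
  shows "is_retract C i j"
proof -
  have "i \<in> homs C (dm C j) (cd C p)"
    using cmp_in_homs[OF C, of j "dm C j" "dm C p" p "cd C p"] j p jp fact by (simp add: homs_def)
  then have d: "dm C j = dm C i" "cd C p = cd C i" by (auto simp: homs_def)
  have ids: "idt C A \<in> homs C A A" if "A \<in> Ob C" for A
    using C that by (auto simp: is_category_def)
  have unit: "cmp C f (idt C (dm C f)) = f" "cmp C (idt C (cd C f)) f = f" if "f \<in> Ar C" for f
    using C that by (auto simp: is_category_def)
  have ob: "dm C i \<in> Ob C" "cd C i \<in> Ob C" using C i by (auto simp: is_category_def)
  have "cmp C p j = cmp C (idt C (cd C i)) i" using fact unit i by simp
  moreover have "j \<in> homs C (dm C i) (dm C p)" using j d jp by (auto simp: homs_def)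
  moreover have "idt C (cd C i) \<in> homs C (cd C i) (cd C p)" using ids ob d by simp
  ultimately obtain h where h: "h \<in> homs C (cd C i) (dm C p)" "cmp C h i = j"
      "cmp C p h = idt C (cd C i)"
    using lift unfolding has_lifting_def by blast
  show ?thesis
    unfolding is_retract_def
  proof (intro bexI conjI)
    show "idt C (dm C i) \<in> homs C (dm C i) (dm C j)" "idt C (dm C i) \<in> homs C (dm C j) (dm C i)"
      using ids ob d by auto
    show "h \<in> homs C (cd C i) (cd C j)" using h jp by simp
    show "p \<in> homs C (cd C j) (cd C i)" using p d jp by (simp add: homs_def)
    show "cmp C (idt C (dm C i)) (idt C (dm C i)) = idt C (dm C i)"
      using unit(1)[of "idt C (dm C i)"] ids[OF ob(1)] by (simp add: homs_def)
    show "cmp C p h = idt C (cd C i)" by fact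
    show "cmp C j (idt C (dm C i)) = cmp C h i" using unit(1)[OF j] h d by simp
    show "cmp C i (idt C (dm C i)) = cmp C p j" using unit(1)[OF i] fact by simp
  qed
qed

text \<open>Factor \<open>i\<close> as a cofibration followed by an acyclic fibration. The lifting
  hypothesis applies to the second factor, so \<open>i\<close> is a retract of the first, and
  cofibrations are closed under retracts.\<close>

lemma cofibrationI:
  assumes C: "is_category C" and M: "model_structure C M" and i: "i \<in> Ar C"
    and lift: "\<And>p. p \<in> fib M \<inter> weq M \<Longrightarrow> has_lifting C i p"
  shows "i \<in> cof M"
proof -
  obtain j p where "j \<in> cof M" "p \<in> fib M \<inter> weq M" "cd C j = dm C p" "cmp C p j = i"
    using M i unfolding model_structure_def by blast
  moreover from this have "j \<in> Ar C" "p \<in> Ar C" using M unfolding model_structure_def by auto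
  ultimately have "is_retract C i j" using retract_of_left_factor[OF C i] lift by blast
  with \<open>j \<in> cof M\<close> \<open>j \<in> Ar C\<close> i M show ?thesis unfolding model_structure_def by blast
qed

text \<open>The same argument with the other factorisation; closure of both \<open>cof M\<close> and
  \<open>weq M\<close> under retracts puts \<open>i\<close> in the intersection.\<close>

lemma acyclic_cofibrationI:
  assumes C: "is_category C" and M: "model_structure C M" and i: "i \<in> Ar C"
    and lift: "\<And>p. p \<in> fib M \<Longrightarrow> has_lifting C i p"
  shows "i \<in> cof M \<inter> weq M"
proof -
  obtain j p where "j \<in> cof M \<inter> weq M" "p \<in> fib M" "cd C j = dm C p" "cmp C p j = i"
    using M i unfolding model_structure_def by blast
  moreover from this have "j \<in> Ar C" "p \<in> Ar C" using M unfolding model_structure_def by auto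
  ultimately have "is_retract C i j" using retract_of_left_factor[OF C i] lift by blast
  with \<open>j \<in> cof M \<inter> weq M\<close> \<open>j \<in> Ar C\<close> i M show ?thesis unfolding model_structure_def by blast
qed

text \<open>Naturality of \<open>\<phi>\<close> in both variables turns a square from
  \<open>amap L i\<close> to \<open>p\<close> into one from \<open>i\<close> to
  \<open>amap R p\<close>, and turns a lift of the latter back into a lift of the former.\<close>

lemma has_lifting_adjoint:
  assumes adj: "adjunction C D L R \<phi>" and i: "i \<in> Ar C" and p: "p \<in> Ar D"
    and lift: "has_lifting C i (amap R p)"
  shows "has_lifting D (amap L i) p"
proof -
  have C: "is_category C" and D: "is_category D" and L: "is_functor C D L" and R: "is_functor D C R"
    and nat: "natural_hom_bijection C D L R \<phi>"
    using adj by (auto simp: adjunction_def)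
  define A B X Y where "A = dm C i" and "B = cd C i" and "X = dm D p" and "Y = cd D p"
  have i': "i \<in> homs C A B" and p': "p \<in> homs D X Y"
    using i p by (auto simp: homs_def A_def B_def X_def Y_def)
  have ob: "A \<in> Ob C" "B \<in> Ob C" "X \<in> Ob D" "Y \<in> Ob D"
    using C D i p by (auto simp: is_category_def A_def B_def X_def Y_def)
  have bij: "bij_betw (\<phi> A' B') (homs D (omap L A') B') (homs C A' (omap R B'))"
    if "A' \<in> Ob C" "B' \<in> Ob D" for A' B'
    using nat that by (auto simp: natural_hom_bijection_def)
  have nat_i: "\<phi> A E (cmp D h (amap L i)) = cmp C (\<phi> B E h) i"
    if "E \<in> Ob D" "h \<in> homs D (omap L B) E" for E h
    using nat that i' ob unfolding natural_hom_bijection_def by blast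
  have nat_p: "\<phi> E Y (cmp D p h) = cmp C (amap R p) (\<phi> E X h)"
    if "E \<in> Ob C" "h \<in> homs D (omap L E) X" for E h
    using nat that p' ob unfolding natural_hom_bijection_def by blast
  have Li: "amap L i \<in> homs D (omap L A) (omap L B)" by (rule functor_in_homs[OF L i'])
  have Rp: "amap R p \<in> homs C (omap R X) (omap R Y)" by (rule functor_in_homs[OF R p'])
  have ends: "dm D (amap L i) = omap L A" "cd D (amap L i) = omap L B"
      "dm C (amap R p) = omap R X" "cd C (amap R p) = omap R Y"
    using Li Rp by (auto simp: homs_def)
  show ?thesis
    unfolding has_lifting_def ends X_def[symmetric] Y_def[symmetric]
  proof (intro ballI impI)
    fix u v assume u: "u \<in> homs D (omap L A) X" and v: "v \<in> homs D (omap L B) Y"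
      and sq: "cmp D p u = cmp D v (amap L i)"
    \<comment> \<open>The transposed square: both of its composites are the transpose of the common
      diagonal \<open>cmp D p u\<close>.\<close>
    have "\<phi> A X u \<in> homs C A (omap R X)" "\<phi> B Y v \<in> homs C B (omap R Y)"
      using bij ob u v by (meson bij_betwE)+
    moreover have "cmp C (amap R p) (\<phi> A X u) = cmp C (\<phi> B Y v) i"
      using nat_p[OF ob(1) u] nat_i[OF ob(4) v] sq by simp
    ultimately obtain k where k: "k \<in> homs C B (omap R X)" "cmp C k i = \<phi> A X u"
        "cmp C (amap R p) k = \<phi> B Y v"
      using lift unfolding has_lifting_def ends A_def[symmetric] B_def[symmetric] by blast
    obtain h where h: "h \<in> homs D (omap L B) X" "\<phi> B X h = k"
      using bij[OF ob(2,3)] k(1) by (metis bij_betw_imp_surj_on imageE)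
    \<comment> \<open>Both triangles for \<open>h\<close> are verified after transposing, where they
      become the triangles for \<open>k\<close>.\<close>
    have inj: "a = b" if "\<phi> A' B' a = \<phi> A' B' b" "a \<in> homs D (omap L A') B'" "b \<in> homs D (omap L A') B'"
        "A' \<in> Ob C" "B' \<in> Ob D" for A' B' a b
      using bij that by (meson bij_betw_imp_inj_on inj_onD)
    have "cmp D h (amap L i) = u"
      by (rule inj[OF _ cmp_in_homs[OF D Li h(1)] u ob(1,3)]) (simp add: nat_i ob h k)
    moreover have "cmp D p h = v"
      by (rule inj[OF _ cmp_in_homs[OF D h(1) p'] v ob(2,4)]) (simp add: nat_p ob h k)
    ultimately show "\<exists>h\<in>homs D (omap L B) X. cmp D h (amap L i) = u \<and> cmp D p h = v"
      using h(1) by blast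
  qed
qed

text \<open>\<open>quillen_adjunction\<close> is phrased through the left adjoint, while a
  projective structure describes fibrations and weak equivalences explicitly. This moves the test to
  the right adjoint.\<close>

lemma quillen_adjunctionI:
  assumes M: "model_structure C M" and N: "model_structure D N" and adj: "adjunction C D L R \<phi>"
    and fib: "\<And>p. p \<in> fib N \<Longrightarrow> amap R p \<in> fib M"
    and weq: "\<And>p. p \<in> fib N \<inter> weq N \<Longrightarrow> amap R p \<in> weq M"
  shows "quillen_adjunction C M D N L R \<phi>"
proof -
  have D: "is_category D" and L: "is_functor C D L" using adj by (auto simp: adjunction_def)
  have ar: "cof M \<subseteq> Ar C" "fib N \<subseteq> Ar D" using M N by (auto simp: model_structure_def)
  have Lar: "amap L i \<in> Ar D" if "i \<in> cof M" for i
    using L ar that by (auto simp: is_functor_def homs_def)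
  have lifts: "has_lifting C i p" if "i \<in> cof M" "p \<in> fib M" "i \<in> weq M \<or> p \<in> weq M" for i p
    using M that unfolding model_structure_def by blast
  have "amap L i \<in> cof N" if i: "i \<in> cof M" for i
  proof (rule cofibrationI[OF D N Lar[OF i]])
    fix p assume "p \<in> fib N \<inter> weq N"
    then show "has_lifting D (amap L i) p"
      using has_lifting_adjoint[OF adj] lifts i fib weq ar by blast
  qed
  moreover have "amap L i \<in> cof N \<inter> weq N" if i: "i \<in> cof M \<inter> weq M" for i
  proof (rule acyclic_cofibrationI[OF D N])
    show "amap L i \<in> Ar D" using Lar i by blast
    fix p assume "p \<in> fib N"
    then show "has_lifting D (amap L i) p"
      using has_lifting_adjoint[OF adj] lifts i fib ar by blast
  qed
  ultimately show ?thesis using M N adj unfolding quillen_adjunction_def by blast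
qed


section \<open>Enriched functor categories and precomposition\<close>

lemma topspace_kify: "topspace (kify X) \<subseteq> topspace X"
proof -
  have "openin (kify X) (topspace (kify X))" by (rule openin_topspace)
  then show ?thesis unfolding kify_def topology_inverse'[OF istopology_k_open] k_open_def by (rule conjunct1)
qed

text \<open>The generating sets consist of based maps and k-ification adds no points. This inclusion
  is what turns continuity of \<open>fmap F U V\<close> into the fact that each of its values is a
  based map.\<close>

lemma topspace_map_space: "topspace (fst (map_space X Y)) \<subseteq> based_maps X Y"
  unfolding map_space_def fst_conv
  by (rule order_trans[OF topspace_kify]) (auto simp: topology_generated_by_topspace)

lemma fmap_in_based_maps:
  assumes "enriched_functor J F" "U \<in> eOb J" "V \<in> eOb J" "f \<in> ehom J U V"
  shows "fmap F U V f \<in> based_maps (fob F U) (fob F V)"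
  using assms topspace_map_space unfolding enriched_functor_def continuous_map_def by blast

lemma based_maps_in_topspace:
  "f \<in> based_maps X Y \<Longrightarrow> x \<in> topspace (fst X) \<Longrightarrow> f x \<in> topspace (fst Y)"
  by (auto simp: based_maps_def continuous_map_def)

lemma based_maps_id:
  "snd X \<in> topspace (fst X) \<Longrightarrow> restrict id (topspace (fst X)) \<in> based_maps X X"
  by (auto simp: based_maps_def intro: continuous_map_eq[OF continuous_map_id])

lemma based_maps_compose:
  assumes "f \<in> based_maps X Y" "g \<in> based_maps Y Z" "snd X \<in> topspace (fst X)"
  shows "compose (topspace (fst X)) g f \<in> based_maps X Z"
proof -
  have "continuous_map (fst X) (fst Z) (compose (topspace (fst X)) g f)"
    by (rule continuous_map_eq[OF continuous_map_compose[of _ "fst Y" f _ g]])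
      (use assms in \<open>auto simp: based_maps_def compose_def\<close>)
  then show ?thesis using assms by (auto simp: based_maps_def compose_def)
qed

lemma basepoint_in_topspace:
  "enriched_functor J F \<Longrightarrow> V \<in> eOb J \<Longrightarrow> snd (fob F V) \<in> topspace (fst (fob F V))"
  by (auto simp: enriched_functor_def top_based_def)

section \<open>The category of enriched functors\<close>

lemma enriched_trans_id:
  assumes F: "enriched_functor J F"
  shows "enriched_trans J (idt (functor_cat J) F)"
  using F unfolding enriched_trans_def functor_cat_def
  by (auto intro!: based_maps_id basepoint_in_topspace[OF F]
      dest: fmap_in_based_maps[OF F] based_maps_in_topspace)

lemma enriched_trans_cmp:
  assumes f: "enriched_trans J \<eta>" and g: "enriched_trans J \<theta>" and eq: "tgt \<eta> = src \<theta>"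
  shows "enriched_trans J (cmp (functor_cat J) \<theta> \<eta>)"
proof -
  have F: "enriched_functor J (src \<eta>)" "enriched_functor J (tgt \<theta>)"
    using f g by (auto simp: enriched_trans_def)
  have b: "comp \<eta> V \<in> based_maps (fob (src \<eta>) V) (fob (src \<theta>) V)"
    "comp \<theta> V \<in> based_maps (fob (src \<theta>) V) (fob (tgt \<theta>) V)" if "V \<in> eOb J" for V
    using f g eq that by (auto simp: enriched_trans_def)
  have nat: "comp \<theta> V (comp \<eta> V (fmap (src \<eta>) U V f x)) = fmap (tgt \<theta>) U V f (comp \<theta> U (comp \<eta> U x))"
    if "U \<in> eOb J" "V \<in> eOb J" "f \<in> ehom J U V" "x \<in> topspace (fst (fob (src \<eta>) U))" for U V f x
  proof -
    have "comp \<eta> V (fmap (src \<eta>) U V f x) = fmap (src \<theta>) U V f (comp \<eta> U x)"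
      using f eq that by (auto simp: enriched_trans_def)
    moreover have "comp \<eta> U x \<in> topspace (fst (fob (src \<theta>) U))"
      by (rule based_maps_in_topspace[OF b(1)]) (use that in auto)
    ultimately show ?thesis using g that by (auto simp: enriched_trans_def)
  qed
  have "compose (topspace (fst (fob (src \<eta>) V))) (comp \<theta> V) (comp \<eta> V)
      \<in> based_maps (fob (src \<eta>) V) (fob (tgt \<theta>) V)" if "V \<in> eOb J" for V
    by (rule based_maps_compose[OF b basepoint_in_topspace[OF F(1)]]) (rule that)+
  moreover have "fmap (src \<eta>) U V f x \<in> topspace (fst (fob (src \<eta>) V))"
    if "U \<in> eOb J" "V \<in> eOb J" "f \<in> ehom J U V" "x \<in> topspace (fst (fob (src \<eta>) U))" for U V f x
    using that by (intro based_maps_in_topspace[OF fmap_in_based_maps[OF F(1)]])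
  ultimately show ?thesis
    using F nat unfolding enriched_trans_def functor_cat_def
    by (simp add: compose_eq)
qed

text \<open>The laws are literal equalities of records. They hold because components are extensional
  both in the object and in the point, so the restrictions built into \<open>cmp\<close> and
  \<open>idt\<close> change nothing.\<close>

lemma is_category_functor_cat:
  "is_category (functor_cat J :: (('o, 'm, 'a) efunctor, ('o, 'm, 'a) etrans) cat)"
proof -
  have ob: "enriched_functor J (src \<eta>)" "enriched_functor J (tgt \<eta>)" if "enriched_trans J \<eta>"
    for \<eta> :: "('o, 'm, 'a) etrans"
    using that by (auto simp: enriched_trans_def)
  have b: "comp \<eta> V \<in> based_maps (fob (src \<eta>) V) (fob (tgt \<eta>) V)" "comp \<eta> \<in> extensional (eOb J)"
    if "enriched_trans J \<eta>" "V \<in> eOb J" for V and \<eta> :: "('o, 'm, 'a) etrans"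
    using that by (auto simp: enriched_trans_def)
  have unit: "cmp (functor_cat J) \<eta> (idt (functor_cat J) (src \<eta>)) = \<eta>"
    "cmp (functor_cat J) (idt (functor_cat J) (tgt \<eta>)) \<eta> = \<eta>"
    if \<eta>: "enriched_trans J \<eta>" for \<eta> :: "('o, 'm, 'a) etrans"
  proof -
    have "(\<lambda>V\<in>eOb J. compose (topspace (fst (fob (src \<eta>) V))) (comp \<eta> V)
        ((\<lambda>V\<in>eOb J. restrict id (topspace (fst (fob (src \<eta>) V)))) V)) = comp \<eta>"
    proof (rule extensionalityI[of _ "eOb J"])
      fix V assume V: "V \<in> eOb J"
      have "comp \<eta> V \<in> extensional (topspace (fst (fob (src \<eta>) V)))"
        using b(1)[OF \<eta> V] by (auto simp: based_maps_def)
      then show "(\<lambda>V\<in>eOb J. compose (topspace (fst (fob (src \<eta>) V))) (comp \<eta> V)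
        ((\<lambda>V\<in>eOb J. restrict id (topspace (fst (fob (src \<eta>) V)))) V)) V = comp \<eta> V"
        using V by (auto simp: compose_def extensional_def)
    qed (use \<eta> in \<open>auto simp: enriched_trans_def\<close>)
    then show "cmp (functor_cat J) \<eta> (idt (functor_cat J) (src \<eta>)) = \<eta>"
      by (simp add: functor_cat_def)
    \<comment> \<open>Here the restricted identity sits on the target, so it acts trivially only
      because \<open>comp \<eta> V\<close> takes values in the target space.\<close>
    have "(\<lambda>V\<in>eOb J. compose (topspace (fst (fob (src \<eta>) V)))
        ((\<lambda>V\<in>eOb J. restrict id (topspace (fst (fob (tgt \<eta>) V)))) V) (comp \<eta> V)) = comp \<eta>"
    proof (rule extensionalityI[of _ "eOb J"])
      fix V assume V: "V \<in> eOb J"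
      have "comp \<eta> V \<in> extensional (topspace (fst (fob (src \<eta>) V)))"
        using b(1)[OF \<eta> V] by (auto simp: based_maps_def)
      then show "(\<lambda>V\<in>eOb J. compose (topspace (fst (fob (src \<eta>) V)))
        ((\<lambda>V\<in>eOb J. restrict id (topspace (fst (fob (tgt \<eta>) V)))) V) (comp \<eta> V)) V = comp \<eta> V"
        using V based_maps_in_topspace[OF b(1)[OF \<eta> V]] by (auto simp: compose_def extensional_def)
    qed (use \<eta> in \<open>auto simp: enriched_trans_def\<close>)
    then show "cmp (functor_cat J) (idt (functor_cat J) (tgt \<eta>)) \<eta> = \<eta>"
      by (simp add: functor_cat_def)
  qed
  \<comment> \<open>Both sides are restricted to the source of \<open>\<eta>\<close>. The inner
    restriction to the source of \<open>\<theta>\<close> on the right is harmless since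
    \<open>comp \<eta> V\<close> lands there.\<close>
  have assoc: "cmp (functor_cat J) \<zeta> (cmp (functor_cat J) \<theta> \<eta>)
      = cmp (functor_cat J) (cmp (functor_cat J) \<zeta> \<theta>) \<eta>"
    if \<eta>: "enriched_trans J \<eta>" and eq: "tgt \<eta> = src \<theta>" for \<eta> \<theta> \<zeta> :: "('o, 'm, 'a) etrans"
    using based_maps_in_topspace[OF b(1)[OF \<eta>]] eq
    by (auto simp: functor_cat_def compose_def fun_eq_iff restrict_def)
  show ?thesis
    unfolding is_category_def homs_def
  proof (intro conjI ballI impI)
    fix \<eta> :: "('o, 'm, 'a) etrans" assume "\<eta> \<in> Ar (functor_cat J)"
    then have \<eta>: "enriched_trans J \<eta>" by (simp add: functor_cat_def)
    show "dm (functor_cat J) \<eta> \<in> Ob (functor_cat J)" "cd (functor_cat J) \<eta> \<in> Ob (functor_cat J)"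
      using ob[OF \<eta>] by (simp_all add: functor_cat_def)
    show "cmp (functor_cat J) \<eta> (idt (functor_cat J) (dm (functor_cat J) \<eta>)) = \<eta>"
      "cmp (functor_cat J) (idt (functor_cat J) (cd (functor_cat J) \<eta>)) \<eta> = \<eta>"
      using unit[OF \<eta>] by (simp_all add: functor_cat_def)
  next
    fix F :: "('o, 'm, 'a) efunctor" assume "F \<in> Ob (functor_cat J)"
    then show "idt (functor_cat J) F \<in> {f \<in> Ar (functor_cat J).
        dm (functor_cat J) f = F \<and> cd (functor_cat J) f = F}"
      using enriched_trans_id[of J F] by (simp add: functor_cat_def)
  next
    fix \<eta> \<theta> :: "('o, 'm, 'a) etrans"
    assume "\<eta> \<in> Ar (functor_cat J)" "\<theta> \<in> Ar (functor_cat J)"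
      "cd (functor_cat J) \<eta> = dm (functor_cat J) \<theta>"
    then show "cmp (functor_cat J) \<theta> \<eta> \<in> {f \<in> Ar (functor_cat J).
        dm (functor_cat J) f = dm (functor_cat J) \<eta> \<and> cd (functor_cat J) f = cd (functor_cat J) \<theta>}"
      using enriched_trans_cmp[of J \<eta> \<theta>] by (simp add: functor_cat_def)
  next
    fix \<eta> \<theta> \<zeta> :: "('o, 'm, 'a) etrans"
    assume "\<eta> \<in> Ar (functor_cat J)" "cd (functor_cat J) \<eta> = dm (functor_cat J) \<theta>"
    then show "cmp (functor_cat J) \<zeta> (cmp (functor_cat J) \<theta> \<eta>)
        = cmp (functor_cat J) (cmp (functor_cat J) \<zeta> \<theta>) \<eta>"
      using assoc[of \<eta> \<theta> \<zeta>] by (simp add: functor_cat_def)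
  qed
qed

section \<open>Precomposition along an enriched functor of index categories\<close>

definition ecat_functor ::
  "('o, 'm) ecat \<Rightarrow> ('p, 'n) ecat \<Rightarrow> ('o \<Rightarrow> 'p) \<Rightarrow> ('o \<Rightarrow> 'o \<Rightarrow> 'm \<Rightarrow> 'n) \<Rightarrow> bool" where
  "ecat_functor J J' k \<kappa> \<longleftrightarrow>
     (\<forall>V\<in>eOb J. k V \<in> eOb J') \<and>
     (\<forall>U\<in>eOb J. \<forall>V\<in>eOb J.
        continuous_map (fst (hom_space J U V)) (fst (hom_space J' (k U) (k V))) (\<kappa> U V) \<and>
        \<kappa> U V (snd (hom_space J U V)) = snd (hom_space J' (k U) (k V))) \<and>
     (\<forall>V\<in>eOb J. \<kappa> V V (hid J V) = hid J' (k V)) \<and>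
     (\<forall>U\<in>eOb J. \<forall>V\<in>eOb J. \<forall>W\<in>eOb J. \<forall>f\<in>ehom J U V. \<forall>g\<in>ehom J V W.
        \<kappa> U W (hcomp J U V W g f) = hcomp J' (k U) (k V) (k W) (\<kappa> V W g) (\<kappa> U V f))"

text \<open>The record \<open>ecat\<close> carries no axioms. Closure is required because
  \<open>precomp_ob\<close> is \<open>undefined\<close> outside the hom spaces, so its values at
  base points, identities and composites are controlled only once these are known to be
  morphisms.\<close>

definition ecat_closed :: "('o, 'm) ecat \<Rightarrow> bool" where
  "ecat_closed J \<longleftrightarrow>
     (\<forall>U\<in>eOb J. \<forall>V\<in>eOb J. snd (hom_space J U V) \<in> ehom J U V) \<and>
     (\<forall>V\<in>eOb J. hid J V \<in> ehom J V V) \<and>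
     (\<forall>U\<in>eOb J. \<forall>V\<in>eOb J. \<forall>W\<in>eOb J. \<forall>f\<in>ehom J U V. \<forall>g\<in>ehom J V W.
        hcomp J U V W g f \<in> ehom J U W)"

lemma ecat_functor_ehom:
  "ecat_functor J J' k \<kappa> \<Longrightarrow> U \<in> eOb J \<Longrightarrow> V \<in> eOb J \<Longrightarrow> f \<in> ehom J U V \<Longrightarrow> \<kappa> U V f \<in> ehom J' (k U) (k V)"
  unfolding ecat_functor_def continuous_map_def by blast

lemma enriched_functor_precomp_ob:
  assumes J: "ecat_closed J" and k: "ecat_functor J J' k \<kappa>" and F: "enriched_functor J' F"
  shows "enriched_functor J (precomp_ob J k \<kappa> F)"
proof -
  have kV: "k V \<in> eOb J'" if "V \<in> eOb J" for V using k that by (auto simp: ecat_functor_def)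
  have cont: "continuous_map (fst (hom_space J U V)) (fst (map_space (fob F (k U)) (fob F (k V))))
      (fmap (precomp_ob J k \<kappa> F) U V)" if U: "U \<in> eOb J" and V: "V \<in> eOb J" for U V
  proof (rule continuous_map_eq[OF continuous_map_compose])
    show "continuous_map (fst (hom_space J U V)) (fst (hom_space J' (k U) (k V))) (\<kappa> U V)"
      using k U V by (auto simp: ecat_functor_def)
    show "continuous_map (fst (hom_space J' (k U) (k V))) (fst (map_space (fob F (k U)) (fob F (k V))))
        (fmap F (k U) (k V))"
      using F kV U V by (auto simp: enriched_functor_def)
  qed (use U V in \<open>auto simp: precomp_ob_def\<close>)
  show ?thesis
    unfolding enriched_functor_def
  proof (intro conjI ballI allI impI)
    fix U V W f g
    assume "U \<in> eOb J" "V \<in> eOb J" "W \<in> eOb J" "f \<in> ehom J U V" "g \<in> ehom J V W"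
    moreover from this have "\<kappa> U V f \<in> ehom J' (k U) (k V)" "\<kappa> V W g \<in> ehom J' (k V) (k W)"
      "hcomp J U V W g f \<in> ehom J U W"
      using ecat_functor_ehom[OF k] J by (auto simp: ecat_closed_def)
    ultimately show "fmap (precomp_ob J k \<kappa> F) U W (hcomp J U V W g f)
      = compose (topspace (fst (fob (precomp_ob J k \<kappa> F) U)))
          (fmap (precomp_ob J k \<kappa> F) V W g) (fmap (precomp_ob J k \<kappa> F) U V f)"
      using F k kV by (auto simp: precomp_ob_def enriched_functor_def ecat_functor_def)
  next
    fix V assume "V \<in> eOb J"
    moreover from this have "hid J V \<in> ehom J V V" using J by (auto simp: ecat_closed_def)
    ultimately show "fmap (precomp_ob J k \<kappa> F) V V (hid J V)
        = restrict id (topspace (fst (fob (precomp_ob J k \<kappa> F) V)))"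
      using F k kV by (auto simp: precomp_ob_def enriched_functor_def ecat_functor_def)
  next
    fix U V assume UV: "U \<in> eOb J" "V \<in> eOb J"
    then show "continuous_map (fst (hom_space J U V))
        (fst (map_space (fob (precomp_ob J k \<kappa> F) U) (fob (precomp_ob J k \<kappa> F) V)))
        (fmap (precomp_ob J k \<kappa> F) U V)"
      using cont by (simp add: precomp_ob_def)
    have "snd (hom_space J U V) \<in> ehom J U V" using J UV by (auto simp: ecat_closed_def)
    then show "fmap (precomp_ob J k \<kappa> F) U V (snd (hom_space J U V))
        = snd (map_space (fob (precomp_ob J k \<kappa> F) U) (fob (precomp_ob J k \<kappa> F) V))"
      using F k kV UV by (auto simp: precomp_ob_def enriched_functor_def ecat_functor_def)
  next
    fix V assume "V \<in> eOb J"
    then show "top_based (fob (precomp_ob J k \<kappa> F) V)"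
      using F kV by (auto simp: precomp_ob_def enriched_functor_def)
  qed (auto simp: precomp_ob_def)
qed

text \<open>Naturality of the restricted transformation at \<open>f\<close> is naturality of
  \<open>\<eta>\<close> at \<open>\<kappa> U V f\<close>.\<close>

lemma enriched_trans_precomp:
  assumes J: "ecat_closed J" and k: "ecat_functor J J' k \<kappa>" and \<eta>: "enriched_trans J' \<eta>"
  shows "enriched_trans J (amap (precomp J k \<kappa>) \<eta>)"
proof -
  have kV: "k V \<in> eOb J'" if "V \<in> eOb J" for V using k that by (auto simp: ecat_functor_def)
  have "enriched_functor J' (src \<eta>)" "enriched_functor J' (tgt \<eta>)"
    using \<eta> by (auto simp: enriched_trans_def)
  then have "enriched_functor J (precomp_ob J k \<kappa> (src \<eta>))"
      "enriched_functor J (precomp_ob J k \<kappa> (tgt \<eta>))"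
    using enriched_functor_precomp_ob[OF J k] by auto
  then show ?thesis
    using \<eta> kV ecat_functor_ehom[OF k]
    by (auto simp: enriched_trans_def precomp_def precomp_ob_def)
qed

lemma is_functor_precomp:
  assumes J: "ecat_closed J" and k: "ecat_functor J J' k \<kappa>"
  shows "is_functor (functor_cat J') (functor_cat J) (precomp J k \<kappa>)"
proof -
  have kV: "k V \<in> eOb J'" if "V \<in> eOb J" for V using k that by (auto simp: ecat_functor_def)
  show ?thesis
    unfolding is_functor_def homs_def
  proof (intro conjI ballI impI)
    fix F :: "('c, 'd, 'e) efunctor" assume "F \<in> Ob (functor_cat J')"
    then show "omap (precomp J k \<kappa>) F \<in> Ob (functor_cat J)"
      using enriched_functor_precomp_ob[OF J k] by (simp add: functor_cat_def precomp_def)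
    show "amap (precomp J k \<kappa>) (idt (functor_cat J') F) = idt (functor_cat J) (omap (precomp J k \<kappa>) F)"
      using kV by (auto simp: functor_cat_def precomp_def precomp_ob_def cong: if_cong)
  next
    fix \<eta> :: "('c, 'd, 'e) etrans" assume "\<eta> \<in> Ar (functor_cat J')"
    then show "amap (precomp J k \<kappa>) \<eta> \<in> {f \<in> Ar (functor_cat J).
        dm (functor_cat J) f = omap (precomp J k \<kappa>) (dm (functor_cat J') \<eta>) \<and>
        cd (functor_cat J) f = omap (precomp J k \<kappa>) (cd (functor_cat J') \<eta>)}"
      using enriched_trans_precomp[OF J k] by (simp add: functor_cat_def) (simp add: precomp_def)
  next
    fix \<eta> \<theta> :: "('c, 'd, 'e) etrans"
    show "amap (precomp J k \<kappa>) (cmp (functor_cat J') \<theta> \<eta>)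
        = cmp (functor_cat J) (amap (precomp J k \<kappa>) \<theta>) (amap (precomp J k \<kappa>) \<eta>)"
      using kV by (auto simp: functor_cat_def precomp_def precomp_ob_def cong: if_cong)
  qed
qed

lemma precomp_levelwise_fib:
  assumes J: "ecat_closed J" and k: "ecat_functor J J' k \<kappa>" and \<eta>: "\<eta> \<in> levelwise_fib J'"
  shows "amap (precomp J k \<kappa>) \<eta> \<in> levelwise_fib J"
  using \<eta> k enriched_trans_precomp[OF J k]
  by (auto simp: levelwise_fib_def ecat_functor_def) (auto simp: precomp_def precomp_ob_def)

lemma precomp_levelwise_weq:
  assumes J: "ecat_closed J" and k: "ecat_functor J J' k \<kappa>" and \<eta>: "\<eta> \<in> levelwise_weq J'"
  shows "amap (precomp J k \<kappa>) \<eta> \<in> levelwise_weq J"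
  using \<eta> k enriched_trans_precomp[OF J k]
  by (auto simp: levelwise_weq_def ecat_functor_def) (auto simp: precomp_def precomp_ob_def)


section \<open>Complexification\<close>

lemma lookup_map_zero: "h 0 = 0 \<Longrightarrow> Poly_Mapping.lookup (Poly_Mapping.map h x) i = h (Poly_Mapping.lookup x i)"
  by (simp add: Poly_Mapping.map.rep_eq when_def)

lemma lookup_cplx:
  "Poly_Mapping.lookup (cplx x y) i = Complex (Poly_Mapping.lookup x i) (Poly_Mapping.lookup y i)"
  by (simp add: cplx_def lookup_add lookup_scl lookup_map_zero complex_eq_iff)

lemma map_Re_cplx [simp]: "Poly_Mapping.map Re (cplx x y) = x"
  and map_Im_cplx [simp]: "Poly_Mapping.map Im (cplx x y) = y"
  by (auto intro!: poly_mapping_eqI simp: lookup_map_zero lookup_cplx)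

lemma cplx_add: "cplx x y + cplx x' y' = cplx (x + x') (y + y')"
  by (auto intro!: poly_mapping_eqI simp: lookup_add lookup_cplx complex_eq_iff)

lemma cplx_diff: "cplx x y - cplx x' y' = cplx (x - x') (y - y')"
  by (auto intro!: poly_mapping_eqI simp: lookup_minus lookup_cplx complex_eq_iff)

text \<open>The real part is written with \<open>scl (- Im c)\<close> rather than as a difference,
  so that additivity and homogeneity of an isometry apply to it directly.\<close>

lemma scl_cplx:
  "scl c (cplx x y) = cplx (scl (Re c) x + scl (- Im c) y) (scl (Re c) y + scl (Im c) x)"
  by (auto intro!: poly_mapping_eqI simp: lookup_add lookup_scl lookup_cplx complex_eq_iff)

text \<open>The class \<open>scalar\<close> does not determine \<open>conj 0\<close>, since \<open>conj_mult_self\<close> is vacuous at \<open>0\<close>.\<close>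

lemma inner_seq_eq_sum:
  assumes "conj (0 :: 'f::scalar) = 0" and "finite A" "Poly_Mapping.keys x \<subseteq> A"
  shows "inner_seq x (y :: 'f seqs) = (\<Sum>i\<in>A. conj (Poly_Mapping.lookup x i) * Poly_Mapping.lookup y i)"
  unfolding inner_seq_def using assms by (intro sum.mono_neutral_left) (auto simp: in_keys_iff)

text \<open>Expansion of a form that is conjugate-linear in its first argument. Since only real
  inner products occur on the right, a map preserving those preserves the Hermitian product after
  complexification.\<close>

lemma inner_seq_cplx:
  "inner_seq (cplx x y) (cplx x' y')
     = Complex (inner_seq x x' + inner_seq y y') (inner_seq x y' - inner_seq y x')"
proof -
  \<comment> \<open>\<open>inner_seq\<close> sums over the support of its first argument only;
    \<open>?A\<close> contains that support for every inner product in the statement.\<close>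
  let ?A = "Poly_Mapping.keys x \<union> Poly_Mapping.keys y"
  have "Poly_Mapping.keys (cplx x y) \<subseteq> ?A"
    by (auto simp: in_keys_iff lookup_cplx complex_eq_iff)
  then show ?thesis
    by (simp add: inner_seq_eq_sum[of ?A] lookup_cplx conj_complex_def conj_real_def complex_eq_iff
        Re_sum Im_sum sum.distrib sum_subtractf)
qed

text \<open>Serves for \<open>Re\<close>, \<open>Im\<close> and the inclusion of the reals, none of
  which increases absolute values.\<close>

lemma norm_seq_map_le:
  assumes "h 0 = 0" and le: "\<And>z. norm (h z) \<le> norm z"
  shows "norm_seq (Poly_Mapping.map h x) \<le> norm_seq x"
proof -
  have "Poly_Mapping.keys (Poly_Mapping.map h x) \<subseteq> Poly_Mapping.keys x"
    using assms(1) by (auto simp: in_keys_iff lookup_map_zero)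
  then show ?thesis
    using assms by (simp add: norm_seq_eq_L2_set[of "Poly_Mapping.keys x"] lookup_map_zero L2_set_mono)
qed

lemma norm_seq_cplx_le: "norm_seq (cplx x y) \<le> norm_seq x + norm_seq y"
proof -
  have "norm_seq (cplx x y) \<le> norm_seq (Poly_Mapping.map complex_of_real x)
      + norm_seq (Poly_Mapping.map complex_of_real y)"
    unfolding cplx_def by (rule order_trans[OF norm_seq_triangle]) (simp add: norm_seq_scl)
  also have "\<dots> \<le> norm_seq x + norm_seq y"
    by (intro add_mono norm_seq_map_le) auto
  finally show ?thesis .
qed

section \<open>Complexification of subspaces\<close>

lemma fd_subspace_add: "fd_subspace V \<Longrightarrow> x \<in> V \<Longrightarrow> y \<in> V \<Longrightarrow> x + y \<in> V"
proof -
  interpret vector_space "scl :: 'a \<Rightarrow> _" by (rule vector_space_scl)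
  show "fd_subspace V \<Longrightarrow> x \<in> V \<Longrightarrow> y \<in> V \<Longrightarrow> x + y \<in> V"
    by (auto simp: fd_subspace_def span_add)
qed

lemma cplx_in_c_ob: "cplx x y \<in> c_ob V \<longleftrightarrow> x \<in> V \<and> y \<in> V"
  unfolding c_ob_def using map_Re_cplx map_Im_cplx by (auto; metis)

lemma c_obE:
  assumes "z \<in> c_ob V"
  obtains x y where "z = cplx x y" "x \<in> V" "y \<in> V"
  using assms by (auto simp: c_ob_def)

text \<open>A finite real spanning set \<open>B\<close> of \<open>V\<close>, viewed inside the
  complex sequences, spans \<open>c_ob V\<close> over the complex numbers.\<close>

lemma fd_subspace_c_ob:
  assumes V: "fd_subspace V"
  shows "fd_subspace (c_ob V)"
proof -
  interpret R: vector_space "scl :: real \<Rightarrow> _" by (rule vector_space_scl)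
  interpret C: vector_space "scl :: complex \<Rightarrow> _" by (rule vector_space_scl)
  obtain B where B: "finite B" "V = R.span B" using V by (auto simp: fd_subspace_def)
  let ?B = "(\<lambda>b. cplx b 0) ` B"
  \<comment> \<open>Differences occur because the real part of a complex multiple of
    \<open>x + iy\<close> is \<open>Re c\<close> times \<open>x\<close> minus \<open>Im c\<close>
    times \<open>y\<close>.\<close>
  have diff: "x - y \<in> V" if "x \<in> V" "y \<in> V" for x y
    using that B R.span_diff by blast
  have "C.subspace (c_ob V)"
    using V unfolding C.subspace_def
    by (auto elim!: c_obE simp: cplx_add cplx_in_c_ob scl_cplx diff fd_subspace_add fd_subspace_scl)
      (metis cplx_in_c_ob fd_subspace_0 poly_mapping_eqI lookup_cplx lookup_zero zero_complex.code)
  moreover have "?B \<subseteq> c_ob V"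
    using B V by (auto simp: cplx_in_c_ob fd_subspace_0 R.span_base)
  ultimately have "C.span ?B \<subseteq> c_ob V" by (rule C.span_minimal[rotated])
  \<comment> \<open>The reverse inclusion is first shown for real vectors, by induction over the
    real span with real scalars read as complex ones; general vectors follow from
    \<open>x + iy\<close>.\<close>
  moreover have re: "cplx x 0 \<in> C.span ?B" if "x \<in> R.span B" for x
    using that
  proof (induction rule: R.span_induct_alt)
    case base
    have "cplx 0 0 = 0" by (auto intro!: poly_mapping_eqI simp: lookup_cplx complex_eq_iff)
    then show ?case by (simp add: C.span_zero)
  next
    case (step c b y)
    have "cplx (scl c b + y) 0 = scl (of_real c) (cplx b 0) + cplx y 0"
      by (auto intro!: poly_mapping_eqI simp: lookup_cplx lookup_add lookup_scl complex_eq_iff)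
    then show ?case using step by (auto intro!: C.span_add C.span_scale intro: C.span_base)
  qed
  have "cplx x y \<in> C.span ?B" if "x \<in> V" "y \<in> V" for x y
  proof -
    have "cplx x y = cplx x 0 + scl \<i> (cplx y 0)"
      by (auto intro!: poly_mapping_eqI simp: lookup_cplx lookup_add lookup_scl complex_eq_iff)
    then show ?thesis using re that B by (auto intro!: C.span_add C.span_scale)
  qed
  ultimately have "c_ob V = C.span ?B" by (auto elim!: c_obE)
  with B show ?thesis unfolding fd_subspace_def by blast
qed

section \<open>Complexification of isometries and its continuity\<close>

definition c_iso :: "real j_ob \<Rightarrow> (real seqs \<Rightarrow> real seqs) \<Rightarrow> complex seqs \<Rightarrow> complex seqs" where
  "c_iso U T = (\<lambda>z\<in>c_ob U. cplx (T (Poly_Mapping.map Re z)) (T (Poly_Mapping.map Im z)))"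

text \<open>Separates the disjoint base point from the map on isometries, so that the metric
  estimates can be made on \<open>lin_isometries\<close>.\<close>

lemma c_mor_eq: "c_mor U V = map_option (c_iso U)"
  by (simp add: c_mor_def c_iso_def[abs_def])

lemma c_iso_cplx: "x \<in> U \<Longrightarrow> y \<in> U \<Longrightarrow> c_iso U T (cplx x y) = cplx (T x) (T y)"
  by (simp add: c_iso_def cplx_in_c_ob)

lemma c_iso_in_lin_isometries:
  assumes U: "fd_subspace U" and T: "T \<in> lin_isometries U V"
  shows "c_iso U T \<in> lin_isometries (c_ob U) (c_ob V)"
proof -
  have T': "T x \<in> V" "T (x + y) = T x + T y" "T (scl c x) = scl c (T x)"
    "inner_seq (T x) (T y) = inner_seq x y" if "x \<in> U" "y \<in> U" for x y c
    using T that by (auto simp: lin_isometries_def)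
  show ?thesis
    unfolding lin_isometries_def
    by (auto elim!: c_obE simp: c_iso_cplx cplx_in_c_ob T' cplx_add scl_cplx inner_seq_cplx
        fd_subspace_add[OF U] fd_subspace_scl[OF U]) (auto simp: c_iso_def)
qed

text \<open>If \<open>z = x + iy\<close> lies in the unit ball, so do \<open>x\<close> and
  \<open>y\<close>, and the difference of the two maps at \<open>z\<close> has real part
  \<open>S x - T x\<close> and imaginary part \<open>S y - T y\<close>. The triangle inequality
  gives the factor 2; any finite factor yields continuity.\<close>

lemma op_dist_c_iso_le:
  assumes U: "fd_subspace U" and S: "S \<in> lin_isometries U V" and T: "T \<in> lin_isometries U V"
  shows "op_dist (c_ob U) (c_ob V) (c_iso U S) (c_iso U T) \<le> 2 * op_dist U V S T"
proof -
  have le: "norm_seq (S x - T x) \<le> op_dist U V S T" if "x \<in> U" "norm_seq x \<le> 1" for x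
    using that S T bdd_op_dist[OF S T] unfolding op_dist_def by (auto intro!: cSUP_upper)
  have "norm_seq (c_iso U S z - c_iso U T z) \<le> 2 * op_dist U V S T"
    if z: "z \<in> c_ob U" "norm_seq z \<le> 1" for z
  proof -
    obtain x y where xy: "z = cplx x y" "x \<in> U" "y \<in> U" using z(1) by (rule c_obE)
    have "norm_seq x \<le> 1" "norm_seq y \<le> 1"
      using norm_seq_map_le[of Re z] norm_seq_map_le[of Im z] abs_Re_le_cmod abs_Im_le_cmod z xy
      by auto
    moreover have "norm_seq (c_iso U S z - c_iso U T z) \<le> norm_seq (S x - T x) + norm_seq (S y - T y)"
      using xy norm_seq_cplx_le by (simp add: c_iso_cplx cplx_diff)
    ultimately show ?thesis using le[of x] le[of y] xy by simp
  qed
  \<comment> \<open>The unit ball must be nonempty for its supremum to be bounded by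
    \<open>cSUP_least\<close>.\<close>
  moreover have "0 \<in> c_ob U" "norm_seq (0 :: complex seqs) = 0"
    using fd_subspace_0 fd_subspace_c_ob[OF U] norm_seq_eq_0_iff by blast+
  then have "0 \<in> {z \<in> c_ob U. norm_seq z \<le> 1}" by simp
  ultimately show ?thesis
    using c_iso_in_lin_isometries[OF U S] c_iso_in_lin_isometries[OF U T]
    unfolding op_dist_def[of "c_ob U"] by (auto intro!: cSUP_least)
qed

lemma continuous_map_c_iso:
  assumes U: "fd_subspace U"
  shows "continuous_map (stiefel U V) (stiefel (c_ob U) (c_ob V)) (c_iso U)"
  unfolding stiefel_def
    Metric_space.metric_continuous_map[OF Metric_space_op_dist[OF U]
      Metric_space_op_dist[OF fd_subspace_c_ob[OF U]]]
proof (intro conjI ballI allI impI)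
  show "c_iso U ` lin_isometries U V \<subseteq> lin_isometries (c_ob U) (c_ob V)"
    using c_iso_in_lin_isometries[OF U] by blast
  fix S and e :: real assume S: "S \<in> lin_isometries U V" and e: "e > 0"
  have "op_dist (c_ob U) (c_ob V) (c_iso U S) (c_iso U T) < e"
    if "T \<in> lin_isometries U V" "op_dist U V S T < e / 2" for T
    using op_dist_c_iso_le[OF U S that(1)] that(2) by simp
  then show "\<exists>d>0. \<forall>T. T \<in> lin_isometries U V \<and> op_dist U V S T < d \<longrightarrow>
      op_dist (c_ob U) (c_ob V) (c_iso U S) (c_iso U T) < e"
    using e by (intro exI[of _ "e / 2"]) auto
qed

section \<open>Disjoint base points and the categories of isometries\<close>

lemma openin_plus_space: "openin (fst (plus_space X)) S \<longleftrightarrow> openin X {x. Some x \<in> S}"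
  by (simp add: plus_space_def istopology_plus_open plus_open_def)

text \<open>\<open>plus_open\<close> constrains only the \<open>Some\<close> part of a set. Hence
  the right-hand side is open, giving one inclusion; the other holds because the whole space is
  open, so its \<open>Some\<close> part is open in \<open>X\<close>.\<close>

lemma topspace_plus_space: "topspace (fst (plus_space X)) = insert None (Some ` topspace X)"
proof
  have "openin (fst (plus_space X)) (insert None (Some ` topspace X))"
    unfolding openin_plus_space by (simp add: image_iff)
  then show "insert None (Some ` topspace X) \<subseteq> topspace (fst (plus_space X))"
    by (rule openin_subset)
  have some: "{x. Some x \<in> topspace (fst (plus_space X))} \<subseteq> topspace X"
    by (rule openin_subset) (simp flip: openin_plus_space)
  show "topspace (fst (plus_space X)) \<subseteq> insert None (Some ` topspace X)"
  proof
    fix a assume "a \<in> topspace (fst (plus_space X))"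
    then show "a \<in> insert None (Some ` topspace X)" using some by (cases a) auto
  qed
qed

lemma continuous_map_plus_space:
  assumes f: "continuous_map X Y f"
  shows "continuous_map (fst (plus_space X)) (fst (plus_space Y)) (map_option f)"
  unfolding continuous_map_def
proof (intro conjI allI impI)
  show "map_option f \<in> topspace (fst (plus_space X)) \<rightarrow> topspace (fst (plus_space Y))"
    using f by (auto simp: topspace_plus_space continuous_map_def)
  fix S assume "openin (fst (plus_space Y)) S"
  then have "openin X {x \<in> topspace X. f x \<in> {y. Some y \<in> S}}"
    using f unfolding openin_plus_space continuous_map_def by blast
  then show "openin (fst (plus_space X)) {x \<in> topspace (fst (plus_space X)). map_option f x \<in> S}"
    unfolding openin_plus_space by (rule back_subst) (auto simp: topspace_plus_space)
qed

lemma topspace_stiefel: "fd_subspace U \<Longrightarrow> topspace (stiefel U V) = lin_isometries U V"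
  by (simp add: stiefel_def Metric_space.topspace_mtopology Metric_space_op_dist)

lemma ehom_J0: "fd_subspace U \<Longrightarrow> ehom J0 U V = insert None (Some ` lin_isometries U V)"
  by (simp add: J0_def topspace_plus_space topspace_stiefel)

lemma restrict_id_lin_isometries: "fd_subspace V \<Longrightarrow> restrict id V \<in> lin_isometries V V"
  by (auto simp: lin_isometries_def fd_subspace_add fd_subspace_scl)

lemma compose_lin_isometries:
  assumes "fd_subspace U" "S \<in> lin_isometries U V" "T \<in> lin_isometries V W"
  shows "compose U T S \<in> lin_isometries U W"
proof -
  have "S x \<in> V" if "x \<in> U" for x using assms(2) that by (auto simp: lin_isometries_def)
  then show ?thesis
    using assms by (auto simp: lin_isometries_def compose_def fd_subspace_add fd_subspace_scl)
qed

lemma ecat_closed_J0: "ecat_closed J0"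
  unfolding ecat_closed_def
proof (intro conjI ballI)
  fix U V W :: "'a j_ob" and f g
  assume "U \<in> eOb J0" "V \<in> eOb J0" "W \<in> eOb J0" "f \<in> ehom J0 U V" "g \<in> ehom J0 V W"
  moreover from this have "fd_subspace U" "fd_subspace V" by (auto simp: J0_def)
  ultimately show "hcomp J0 U V W g f \<in> ehom J0 U W"
    by (auto simp: ehom_J0) (auto simp: J0_def intro!: imageI compose_lin_isometries)
next
  fix U V :: "'a j_ob" assume "U \<in> eOb J0"
  then have U: "fd_subspace U" by (simp add: J0_def)
  show "snd (hom_space J0 U V) \<in> ehom J0 U V"
    unfolding ehom_J0[OF U] by (simp add: J0_def plus_space_def)
  show "hid J0 U \<in> ehom J0 U U"
    unfolding ehom_J0[OF U] using restrict_id_lin_isometries[OF U] by (simp add: J0_def)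
qed

lemma c_iso_id: "c_iso V (restrict id V) = restrict id (c_ob V)"
  by (rule extensionalityI[of _ "c_ob V"]) (auto elim!: c_obE simp: c_iso_cplx cplx_in_c_ob, simp add: c_iso_def)

lemma c_iso_compose:
  assumes "S \<in> lin_isometries U V"
  shows "c_iso U (compose U T S) = compose (c_ob U) (c_iso V T) (c_iso U S)"
proof (rule extensionalityI[of _ "c_ob U"])
  fix z assume "z \<in> c_ob U"
  moreover have "S x \<in> V" if "x \<in> U" for x using assms that by (auto simp: lin_isometries_def)
  ultimately show "c_iso U (compose U T S) z = compose (c_ob U) (c_iso V T) (c_iso U S) z"
    by (auto elim!: c_obE simp: c_iso_cplx cplx_in_c_ob compose_def)
qed (auto simp: c_iso_def)

text \<open>Since \<open>map_option\<close> fixes \<open>None\<close>, base points and composites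
  involving them are preserved by construction; the rest is continuity and functoriality of
  \<open>c_iso\<close>.\<close>

lemma ecat_functor_complexification: "ecat_functor J0_O J0_U c_ob c_mor"
  unfolding ecat_functor_def
proof (intro conjI ballI)
  fix U V W :: "real j_ob" and f g
  assume "U \<in> eOb J0" "V \<in> eOb J0" "W \<in> eOb J0" "f \<in> ehom J0 U V" "g \<in> ehom J0 V W"
  moreover from this have "fd_subspace U" "fd_subspace V" by (auto simp: J0_def)
  ultimately show "c_mor U W (hcomp J0 U V W g f)
      = hcomp J0 (c_ob U) (c_ob V) (c_ob W) (c_mor V W g) (c_mor U V f)"
    using c_iso_compose by (auto simp: ehom_J0) (auto simp: J0_def c_mor_eq)
next
  fix U V :: "real j_ob" assume "U \<in> eOb J0"
  then have "continuous_map (stiefel U V) (stiefel (c_ob U) (c_ob V)) (c_iso U)"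
    by (intro continuous_map_c_iso) (simp add: J0_def)
  then show "continuous_map (fst (hom_space J0 U V)) (fst (hom_space J0 (c_ob U) (c_ob V))) (c_mor U V)"
    by (simp add: J0_def c_mor_eq continuous_map_plus_space)
qed (auto simp: J0_def fd_subspace_c_ob plus_space_def c_mor_eq c_iso_id)

text \<open>Left adjoints are unique up to natural isomorphism, so \<open>c_shriek\<close> enters
  only as a functor with a natural hom bijection; this covers the enriched left Kan extension and
  every isomorphic choice.\<close>

theorem lemma3p2:
  fixes M_O :: "'a ar_O model" and M_U :: "'a ar_U model"
    and c_shriek :: "('a ob_O, 'a ar_O, 'a ob_U, 'a ar_U) functr"
    and \<phi> :: "'a ob_O \<Rightarrow> 'a ob_U \<Rightarrow> 'a ar_U \<Rightarrow> 'a ar_O"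
  assumes "projective_model_structure J0_O M_O"
    and "projective_model_structure J0_U M_U"
    and "is_functor E0_O E0_U c_shriek"
    and "natural_hom_bijection E0_O E0_U c_shriek c_star \<phi>"
  shows "quillen_adjunction E0_O M_O E0_U M_U c_shriek c_star \<phi>"
proof (rule quillen_adjunctionI)
  note c = ecat_closed_J0 ecat_functor_complexification
  show "adjunction E0_O E0_U c_shriek c_star \<phi>"
    unfolding adjunction_def
    \<comment> \<open>What remains of the adjunction is that both functor categories are categories
      and that \<open>c_star\<close> is a functor between them.\<close>
    using assms(3,4) is_functor_precomp[OF c] by (simp add: is_category_functor_cat c_star_def)
  show "amap c_star p \<in> fib M_O" if "p \<in> fib M_U" for p
    using that assms(1,2) by (simp add: projective_model_structure_def c_star_def precomp_levelwise_fib[OF c])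
  show "amap c_star p \<in> weq M_O" if "p \<in> fib M_U \<inter> weq M_U" for p
    using that assms(1,2) by (simp add: projective_model_structure_def c_star_def precomp_levelwise_weq[OF c])
qed (use assms(1,2) in \<open>auto simp: projective_model_structure_def\<close>)

end
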